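(* Let $(\bar x,\bar\lambda)\in\mathbb{R}^n\times\mathbb{R}^{m+1}$ be a solution to the KKT system $$\nabla f(x)+\nabla\Phi(x)^*\lambda=0,\qquad \lambda\in N_{\mathcal Q}(\Phi(x)),$$ and let $\rho_{\bar\lambda},\gamma_{\bar\lambda},\ell_{\bar\lambda}$ be positive constants such that for every $\rho\ge\rho_{\bar\lambda}$ the second-order growth condition $$\mathscr{L}(x,\bar\lambda,\rho)\ge f(\bar x)+\ell_{\bar\lambda}\|x-\bar x\|^2\quad\text{for all }x\in\mathbb{B}_{\gamma_{\bar\lambda}}(\bar x)$$ holds. Then there exist constants $\ell>0$, $\hat\gamma\in(0,\gamma_{\bar\lambda}]$, and $\varepsilon>0$ such that the local optimal solution mapping $S_\rho:\mathbb{R}^{m+1}\rightrightarrows\mathbb{R}^n$ defined by $$S_\rho(\lambda):=\mathrm{argmin}\big\{\mathscr{L}(x,\lambda,\rho)\;\big|\;x\in\mathbb{B}_{\hat\gamma}(\bar x)\big\},\quad\lambda\in\mathbb{R}^{m+1},$$ satisfies, for all $\lambda\in\mathbb{B}_\varepsilon(\bar\lambda)$ and all $\rho\in[\rho_{\bar\lambda},\infty)$, the inclusions $$S_\rho(\lambda)\subset\{\bar x\}+\ell\|\lambda-\bar\lambda\|\mathbb{B}\quad\text{and}\quad\emptyset\ne S_\rho(\lambda)\subset\mathrm{int}\,\mathbb{B}_{\hat\gamma}(\bar x).$$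
   Context: Setting: the second-order cone program "minimize $f(x)$ subject to $\Phi(x)\in\mathcal Q$", where $f:\mathbb{R}^n\to\mathbb{R}$ and $\Phi:\mathbb{R}^n\to\mathbb{R}^{m+1}$ are twice continuously differentiable around the reference point $\bar x$, and $\mathcal Q:=\{y=(y_0,y_r)\in\mathbb{R}\times\mathbb{R}^m\mid\|y_r\|\le y_0\}$. $\mathbb{B}$ is the closed unit ball, $\mathbb{B}_\gamma(z)$ the closed ball of radius $\gamma$ centered at $z$; $A^*$ is the transpose of $A$; $N_{\mathcal Q}$ is the convex-analysis normal cone to $\mathcal Q$. The augmented Lagrangian is $$\mathscr{L}(x,\lambda,\rho):=f(x)+\tfrac{\rho}{2}\mathrm{dist}^2\big(\Phi(x)+\rho^{-1}\lambda;\mathcal Q\big)-\tfrac12\rho^{-1}\|\lambda\|^2,\quad(x,\lambda,\rho)\in\mathbb{R}^n\times\mathbb{R}^{m+1}\times(0,\infty).$$ *)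

theory Defs
  imports "HOL-Analysis.Analysis"
begin

definition C2_around ::
  "('a::euclidean_space \<Rightarrow> 'b::euclidean_space) \<Rightarrow> 'a \<Rightarrow> bool" where
  "C2_around g z \<longleftrightarrow>
    (\<exists>U (D :: 'a \<Rightarrow> 'a \<Rightarrow>\<^sub>L 'b) (D2 :: 'a \<Rightarrow> 'a \<Rightarrow>\<^sub>L 'a \<Rightarrow>\<^sub>L 'b).
       open U \<and> z \<in> U \<and>
       (\<forall>x\<in>U. (g has_derivative blinfun_apply (D x)) (at x)) \<and>
       (\<forall>x\<in>U. (D has_derivative blinfun_apply (D2 x)) (at x)) \<and>
       continuous_on U D2)"

(* Meaningful only where g is differentiable. *)
definition gradient :: "('a::euclidean_space \<Rightarrow> real) \<Rightarrow> 'a \<Rightarrow> 'a" where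
  "gradient g x = (THE d. GDERIV g x :> d)"

(* The normal cone of convex analysis; empty at points outside the set. *)
definition normal_cone :: "'a::euclidean_space set \<Rightarrow> 'a \<Rightarrow> 'a set" where
  "normal_cone C z = {v. z \<in> C \<and> (\<forall>y\<in>C. v \<bullet> (y - z) \<le> 0)}"

(* R^(m+1) is the product real \<times> (real^'m), whose norm and inner product are the
   Euclidean ones; m = CARD('m). *)
definition soc :: "(real \<times> (real^'m)) set" where
  "soc = {y. norm (snd y) \<le> fst y}"

definition kkt_solution ::
  "(real^'n \<Rightarrow> real) \<Rightarrow> (real^'n \<Rightarrow> real \<times> (real^'m)) \<Rightarrow> real^'n \<Rightarrow> real \<times> (real^'m) \<Rightarrow> bool" where
  "kkt_solution f \<Phi> x \<mu> \<longleftrightarrow>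
     gradient f x + adjoint (frechet_derivative \<Phi> (at x)) \<mu> = 0 \<and>
     \<mu> \<in> normal_cone soc (\<Phi> x)"

definition aug_lagrangian ::
  "(real^'n \<Rightarrow> real) \<Rightarrow> (real^'n \<Rightarrow> real \<times> (real^'m)) \<Rightarrow>
   real^'n \<Rightarrow> real \<times> (real^'m) \<Rightarrow> real \<Rightarrow> real" where
  "aug_lagrangian f \<Phi> x \<mu> \<rho> =
     f x + \<rho> / 2 * (infdist (\<Phi> x + inverse \<rho> *\<^sub>R \<mu>) soc)\<^sup>2
         - 1 / 2 * inverse \<rho> * (norm \<mu>)\<^sup>2"

(* S_rho(mu): the global minimizers over the closed ball of radius \<gamma> around xb. *)
definition local_solutions ::
  "(real^'n \<Rightarrow> real) \<Rightarrow> (real^'n \<Rightarrow> real \<times> (real^'m)) \<Rightarrow>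
   real^'n \<Rightarrow> real \<Rightarrow> real \<Rightarrow> real \<times> (real^'m) \<Rightarrow> (real^'n) set" where
  "local_solutions f \<Phi> xb \<gamma> \<rho> \<mu> =
     {x. is_arg_min (\<lambda>x. aug_lagrangian f \<Phi> x \<mu> \<rho>) (\<lambda>x. x \<in> cball xb \<gamma>) x}"

end

(* The augmented Lagrangian is concave in the multiplier, with supergradient
   \<Phi>(x) - P(\<Phi>(x) + \<mu>/\<rho>) at \<mu>, where P is the projection onto the cone. Since
   P(\<Phi>(xb) + \<mu>b/\<rho>) = \<Phi>(xb) by complementarity and P is nonexpansive, this supergradient is
   bounded by 2 K |x - xb| + |\<mu> - \<mu>b| / \<rho>, K being a calmness constant of \<Phi> at xb.
   A minimizer x for \<mu> has value at most that at xb, hence at most f(xb); with the growth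
   condition, t = |x - xb| and \<delta> = |\<mu> - \<mu>b| satisfy lb t^2 <= (2 K t + \<delta> / \<rho>b) \<delta>, so t = O(\<delta>)
   uniformly in \<rho>. *)
theory Submission
  imports Defs
begin

text \<open>The infimum is attained at the projection, so the squared distance in
  \<open>aug_lagrangian\<close> can be expanded around a concrete point of the cone.\<close>

lemma infdist_eq_dist_closest_point:
  fixes S :: "'a::euclidean_space set"
  assumes "closed S" "S \<noteq> {}"
  shows "infdist y S = dist y (closest_point S y)"
proof (rule antisym)
  show "infdist y S \<le> dist y (closest_point S y)"
    using assms by (intro infdist_le closest_point_in_set)
  show "dist y (closest_point S y) \<le> infdist y S"
    unfolding infdist_notempty[OF assms(2)]
    using assms by (intro cINF_greatest) (auto intro: closest_point_le)
qed

text \<open>The normal cone inequality makes the cross term of the expanded square nonnegative, so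
  no \<open>y\<close> in \<open>C\<close> is closer than \<open>z\<close>. With
  \<open>z = \<Phi> xb\<close> and \<open>v = \<mu>b\<close> this fixes the projection for every
  \<rho> at once.\<close>

lemma closest_point_add_normal:
  fixes C :: "'a::euclidean_space set"
  assumes "closed C" "convex C" "v \<in> normal_cone C z" "t \<ge> 0"
  shows "closest_point C (z + t *\<^sub>R v) = z"
proof (rule sym, rule closest_point_unique[OF assms(2,1)])
  show "z \<in> C" using assms(3) by (simp add: normal_cone_def)
  show "\<forall>y\<in>C. dist (z + t *\<^sub>R v) z \<le> dist (z + t *\<^sub>R v) y"
  proof
    fix y assume "y \<in> C"
    then have "t * (v \<bullet> (y - z)) \<le> 0"
      using assms(3,4) by (simp add: normal_cone_def mult_nonneg_nonpos)
    moreover have "(norm (t *\<^sub>R v - (y - z)))\<^sup>2 =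
        (norm (t *\<^sub>R v))\<^sup>2 - 2 * (t * (v \<bullet> (y - z))) + (norm (y - z))\<^sup>2"
      by (simp only: power2_norm_eq_inner)
        (simp add: inner_diff_left inner_diff_right inner_commute algebra_simps)
    ultimately have "(norm (t *\<^sub>R v))\<^sup>2 \<le> (norm (t *\<^sub>R v - (y - z)))\<^sup>2"
      using zero_le_power2[of "norm (y - z)"] by linarith
    then have "norm (t *\<^sub>R v) \<le> norm (t *\<^sub>R v - (y - z))"
      by (rule power2_le_imp_le) simp
    then show "dist (z + t *\<^sub>R v) z \<le> dist (z + t *\<^sub>R v) y"
      by (simp add: dist_norm algebra_simps)
  qed
qed

text \<open>Tolerance 1 in the definition of the derivative bounds the remainder by
  \<open>norm (x - z)\<close>, and the linear part contributes \<open>onorm g'\<close>; their sum is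
  \<open>K\<close>.\<close>

lemma has_derivative_imp_calm:
  fixes g :: "'a::euclidean_space \<Rightarrow> 'b::real_normed_vector"
  assumes "(g has_derivative g') (at z)"
  obtains r K where "r > 0" "K \<ge> 0" "\<And>x. x \<in> ball z r \<Longrightarrow> norm (g x - g z) \<le> K * norm (x - z)"
proof -
  from assms have bl: "bounded_linear g'" by (rule has_derivative_bounded_linear)
  obtain r where r: "r > 0"
    "\<And>x. norm (x - z) < r \<Longrightarrow> norm (g x - g z - g' (x - z)) \<le> 1 * norm (x - z)"
    using assms unfolding has_derivative_at_alt by (metis zero_less_one)
  have "norm (g x - g z) \<le> (onorm g' + 1) * norm (x - z)" if "x \<in> ball z r" for x
  proof -
    have "norm (g x - g z - g' (x - z)) \<le> norm (x - z)"
      using r(2)[of x] that by (simp add: dist_norm norm_minus_commute)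
    moreover have "norm (g' (x - z)) \<le> onorm g' * norm (x - z)" by (rule onorm[OF bl])
    moreover have "norm (g x - g z) \<le> norm (g x - g z - g' (x - z)) + norm (g' (x - z))"
      using norm_triangle_ineq[of "g x - g z - g' (x - z)" "g' (x - z)"] by simp
    ultimately show ?thesis by (simp add: distrib_right)
  qed
  moreover have "onorm g' + 1 \<ge> 0" using onorm_pos_le[OF bl] by simp
  ultimately show ?thesis using that r(1) by blast
qed

lemma C2_around_imp_has_derivative:
  assumes "C2_around g z"
  obtains g' where "(g has_derivative g') (at z)"
  using assms unfolding C2_around_def by blast

text \<open>Existence of minimizers needs continuity on a whole ball, hence a neighbourhood and not
  just the point \<open>z\<close>.\<close>

lemma C2_around_imp_continuous:
  assumes "C2_around g z"
  obtains U where "open U" "z \<in> U" "continuous_on U g"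
proof -
  obtain U D where "open U" "z \<in> U" "\<forall>x\<in>U. (g has_derivative blinfun_apply (D x)) (at x)"
    using assms unfolding C2_around_def by blast
  then show ?thesis
    by (meson that continuous_at_imp_continuous_on has_derivative_continuous)
qed

lemma closed_soc: "closed (soc :: (real \<times> (real^'m)) set)"
  unfolding soc_def by (intro closed_Collect_le continuous_intros)

lemma convex_soc: "convex (soc :: (real \<times> (real^'m)) set)"
  unfolding convex_alt soc_def
proof (intro ballI allI impI, unfold mem_Collect_eq)
  fix x y :: "real \<times> (real^'m)" and u :: real
  assume h: "norm (snd x) \<le> fst x" "norm (snd y) \<le> fst y" "0 \<le> u \<and> u \<le> 1"
  have "norm (snd ((1 - u) *\<^sub>R x + u *\<^sub>R y)) \<le> (1 - u) * norm (snd x) + u * norm (snd y)"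
    using norm_triangle_ineq[of "(1 - u) *\<^sub>R snd x" "u *\<^sub>R snd y"] h(3) by simp
  also have "\<dots> \<le> (1 - u) * fst x + u * fst y"
    using h by (intro add_mono mult_left_mono) auto
  finally show "norm (snd ((1 - u) *\<^sub>R x + u *\<^sub>R y)) \<le> fst ((1 - u) *\<^sub>R x + u *\<^sub>R y)" by simp
qed

lemma soc_nonempty: "(soc :: (real \<times> (real^'m)) set) \<noteq> {}"
  unfolding soc_def by (auto intro!: exI[of _ 0])

text \<open>The feasible point \<open>\<Phi> x\<close> is itself a candidate in the distance, so the
  penalty is at most the multiplier term that is subtracted.\<close>

lemma aug_lagrangian_le_objective:
  assumes "\<Phi> x \<in> soc" "\<rho> > 0"
  shows "aug_lagrangian f \<Phi> x \<mu> \<rho> \<le> f x"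
proof -
  have "infdist (\<Phi> x + inverse \<rho> *\<^sub>R \<mu>) soc \<le> inverse \<rho> * norm \<mu>"
    using infdist_le[OF assms(1), of "\<Phi> x + inverse \<rho> *\<^sub>R \<mu>"] assms(2) by (simp add: dist_norm)
  then have "(infdist (\<Phi> x + inverse \<rho> *\<^sub>R \<mu>) soc)\<^sup>2 \<le> (inverse \<rho> * norm \<mu>)\<^sup>2"
    by (intro power_mono infdist_nonneg)
  then have "\<rho> / 2 * (infdist (\<Phi> x + inverse \<rho> *\<^sub>R \<mu>) soc)\<^sup>2 \<le> \<rho> / 2 * (inverse \<rho> * norm \<mu>)\<^sup>2"
    using assms(2) by (intro mult_left_mono) auto
  also have "\<dots> = 1 / 2 * inverse \<rho> * (norm \<mu>)\<^sup>2"
    using assms(2) by (simp add: field_simps power2_eq_square)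
  finally show ?thesis by (simp add: aug_lagrangian_def)
qed

text \<open>The projection \<open>p\<close> belonging to \<mu> serves as a competitor in the
  distance for \<nu>. With \<open>p\<close> fixed, the terms quadratic in the multiplier cancel, and
  what remains is affine in \<nu> and exact at \<mu>.\<close>

lemma aug_lagrangian_supergradient:
  assumes "\<rho> > 0"
  shows "aug_lagrangian f \<Phi> x \<nu> \<rho> \<le> aug_lagrangian f \<Phi> x \<mu> \<rho>
     + (\<Phi> x - closest_point soc (\<Phi> x + inverse \<rho> *\<^sub>R \<mu>)) \<bullet> (\<nu> - \<mu>)"
proof -
  define y where "y = \<Phi> x + inverse \<rho> *\<^sub>R \<mu>"
  define p where "p = closest_point soc y"
  define d where "d = \<nu> - \<mu>"
  have "infdist (\<Phi> x + inverse \<rho> *\<^sub>R \<nu>) soc \<le> dist (\<Phi> x + inverse \<rho> *\<^sub>R \<nu>) p"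
    unfolding p_def by (intro infdist_le closest_point_in_set closed_soc soc_nonempty)
  also have "\<dots> = norm (y - p + inverse \<rho> *\<^sub>R d)"
    by (simp add: dist_norm y_def d_def algebra_simps)
  finally have "(infdist (\<Phi> x + inverse \<rho> *\<^sub>R \<nu>) soc)\<^sup>2 \<le> (norm (y - p + inverse \<rho> *\<^sub>R d))\<^sup>2"
    by (intro power_mono infdist_nonneg)
  then have "\<rho> / 2 * (infdist (\<Phi> x + inverse \<rho> *\<^sub>R \<nu>) soc)\<^sup>2
      \<le> \<rho> / 2 * (norm (y - p + inverse \<rho> *\<^sub>R d))\<^sup>2"
    using assms by (intro mult_left_mono) auto
  also have "(norm (y - p + inverse \<rho> *\<^sub>R d))\<^sup>2
      = (norm (y - p))\<^sup>2 + 2 * inverse \<rho> * ((y - p) \<bullet> d) + (inverse \<rho>)\<^sup>2 * (norm d)\<^sup>2"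
    unfolding power2_norm_eq_inner
    by (simp add: inner_add_left inner_add_right inner_commute power2_eq_square algebra_simps)
  also have "\<rho> / 2 * \<dots> = \<rho> / 2 * (norm (y - p))\<^sup>2 + (y - p) \<bullet> d + 1 / 2 * inverse \<rho> * (norm d)\<^sup>2"
    using assms by (simp add: field_simps power2_eq_square)
  also have "(y - p) \<bullet> d = (\<Phi> x - p) \<bullet> d + inverse \<rho> * (\<mu> \<bullet> d)"
    by (simp add: y_def inner_diff_left inner_add_left)
  finally have "\<rho> / 2 * (infdist (\<Phi> x + inverse \<rho> *\<^sub>R \<nu>) soc)\<^sup>2
     \<le> \<rho> / 2 * (norm (y - p))\<^sup>2 + (\<Phi> x - p) \<bullet> d
       + 1 / 2 * inverse \<rho> * (2 * (\<mu> \<bullet> d) + (norm d)\<^sup>2)"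
    by (simp add: algebra_simps)
  \<comment> \<open>This is the expansion of the square at \<open>\<nu> = \<mu> + d\<close>; it
    absorbs the difference of the two subtracted multiplier terms.\<close>
  also have "2 * (\<mu> \<bullet> d) + (norm d)\<^sup>2 = (norm \<nu>)\<^sup>2 - (norm \<mu>)\<^sup>2"
    unfolding power2_norm_eq_inner d_def
    by (simp add: inner_diff_left inner_diff_right inner_commute)
  finally have "\<rho> / 2 * (infdist (\<Phi> x + inverse \<rho> *\<^sub>R \<nu>) soc)\<^sup>2
     \<le> \<rho> / 2 * (infdist y soc)\<^sup>2 + (\<Phi> x - p) \<bullet> d
       + 1 / 2 * inverse \<rho> * ((norm \<nu>)\<^sup>2 - (norm \<mu>)\<^sup>2)"
    by (simp add: infdist_eq_dist_closest_point[OF closed_soc soc_nonempty] dist_norm p_def)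
  then show ?thesis
    unfolding aug_lagrangian_def y_def[symmetric] p_def[symmetric] d_def[symmetric]
    by (simp add: algebra_simps)
qed

text \<open>The factor 2 counts \<open>\<Phi> x - \<Phi> xb\<close> twice: once in the detour
  through \<open>\<Phi> xb\<close>, once in the distance between the two projected points.\<close>

lemma supergradient_norm_le:
  assumes "\<mu>b \<in> normal_cone soc (\<Phi> xb)" "\<rho> > 0"
  shows "norm (\<Phi> x - closest_point soc (\<Phi> x + inverse \<rho> *\<^sub>R \<mu>))
    \<le> 2 * norm (\<Phi> x - \<Phi> xb) + inverse \<rho> * norm (\<mu> - \<mu>b)"
proof -
  let ?P = "closest_point soc"
  let ?y = "\<Phi> x + inverse \<rho> *\<^sub>R \<mu>" and ?yb = "\<Phi> xb + inverse \<rho> *\<^sub>R \<mu>b"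
  have P: "?P ?yb = \<Phi> xb"
    using assms by (intro closest_point_add_normal closed_soc convex_soc) auto
  have "norm (?P ?yb - ?P ?y) \<le> norm (?yb - ?y)"
    using closest_point_lipschitz[OF convex_soc closed_soc soc_nonempty, of ?yb ?y]
    by (simp add: dist_norm)
  also have "\<dots> = norm ((\<Phi> x - \<Phi> xb) + inverse \<rho> *\<^sub>R (\<mu> - \<mu>b))"
    by (subst norm_minus_commute) (simp add: algebra_simps)
  also have "\<dots> \<le> norm (\<Phi> x - \<Phi> xb) + norm (inverse \<rho> *\<^sub>R (\<mu> - \<mu>b))"
    by (rule norm_triangle_ineq)
  also have "\<dots> = norm (\<Phi> x - \<Phi> xb) + inverse \<rho> * norm (\<mu> - \<mu>b)"
    using assms(2) by simp
  finally have "norm (\<Phi> xb - ?P ?y) \<le> norm (\<Phi> x - \<Phi> xb) + inverse \<rho> * norm (\<mu> - \<mu>b)"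
    by (simp add: P)
  moreover have "norm (\<Phi> x - ?P ?y) \<le> norm (\<Phi> x - \<Phi> xb) + norm (\<Phi> xb - ?P ?y)"
    using norm_triangle_ineq[of "\<Phi> x - \<Phi> xb" "\<Phi> xb - ?P ?y"] by simp
  ultimately show ?thesis by simp
qed

lemma local_solutions_nonempty:
  assumes "\<gamma> \<ge> 0" "continuous_on (cball xb \<gamma>) f" "continuous_on (cball xb \<gamma>) \<Phi>"
  shows "local_solutions f \<Phi> xb \<gamma> \<rho> \<mu> \<noteq> {}"
proof -
  have "continuous_on (cball xb \<gamma>) (\<lambda>x. aug_lagrangian f \<Phi> x \<mu> \<rho>)"
    unfolding aug_lagrangian_def by (intro continuous_intros assms(2,3))
  then obtain x where "x \<in> cball xb \<gamma>"
    "\<And>y. y \<in> cball xb \<gamma> \<Longrightarrow> aug_lagrangian f \<Phi> x \<mu> \<rho> \<le> aug_lagrangian f \<Phi> y \<mu> \<rho>"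
    using continuous_attains_inf[OF compact_cball] assms(1)
    by (metis centre_in_cball empty_iff)
  then have "x \<in> local_solutions f \<Phi> xb \<gamma> \<rho> \<mu>"
    by (auto simp: local_solutions_def is_arg_min_linorder)
  then show ?thesis by blast
qed

text \<open>If \<open>l * \<delta> < t\<close>, then also \<open>\<delta> \<le> t\<close> because
  \<open>l \<ge> 1\<close>. Multiplying the hypothesis by \<open>l\<close> and replacing both
  \<open>\<delta>\<close> and \<open>l * \<delta>\<close> by \<open>t\<close> leaves
  \<open>c * l * t\<^sup>2 \<le> (a + b) * t\<^sup>2\<close>, which is impossible.\<close>

lemma quadratic_growth_imp_linear_bound:
  fixes t \<delta> c a b l :: real
  assumes "c * t\<^sup>2 \<le> (a * t + b * \<delta>) * \<delta>"
    and "t \<ge> 0" "\<delta> \<ge> 0" "a \<ge> 0" "b \<ge> 0" "l \<ge> 1" "a + b < c * l"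
  shows "t \<le> l * \<delta>"
proof (rule ccontr)
  assume "\<not> t \<le> l * \<delta>"
  then have lt: "l * \<delta> < t" by simp
  have t0: "0 < t" by (rule le_less_trans[OF _ lt]) (use assms in simp)
  have "\<delta> \<le> l * \<delta>" using assms(3,6) mult_right_mono[of 1 l \<delta>] by simp
  then have dt: "\<delta> \<le> t" using lt by simp
  have "l * (c * t\<^sup>2) \<le> l * ((a * t + b * \<delta>) * \<delta>)"
    using assms(1,6) by (intro mult_left_mono) auto
  also have "\<dots> = (a * t + b * \<delta>) * (l * \<delta>)" by simp
  also have "\<dots> \<le> (a * t + b * t) * t"
    using assms dt lt t0 by (intro mult_mono add_mono mult_left_mono) auto
  also have "\<dots> = (a + b) * t\<^sup>2" by (simp add: power2_eq_square algebra_simps)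
  also have "\<dots> < c * l * t\<^sup>2" using assms(7) t0 by simp
  finally show False by (simp add: mult_ac)
qed

theorem theorem5p2:
  fixes f :: "real^'n \<Rightarrow> real"
    and \<Phi> :: "real^'n \<Rightarrow> real \<times> (real^'m)"
    and xb :: "real^'n"
    and \<mu>b :: "real \<times> (real^'m)"
    and \<rho>b \<gamma>b lb :: real
  assumes "C2_around f xb"
    and "C2_around \<Phi> xb"
    and "kkt_solution f \<Phi> xb \<mu>b"
    and "\<rho>b > 0" "\<gamma>b > 0" "lb > 0"
    and "\<forall>\<rho>\<ge>\<rho>b. \<forall>x\<in>cball xb \<gamma>b.
           aug_lagrangian f \<Phi> x \<mu>b \<rho> \<ge> f xb + lb * (norm (x - xb))\<^sup>2"
  shows "\<exists>l>0. \<exists>\<gamma>\<in>{0<..\<gamma>b}. \<exists>\<epsilon>>0.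
           \<forall>\<mu>\<in>cball \<mu>b \<epsilon>. \<forall>\<rho>\<ge>\<rho>b.
             local_solutions f \<Phi> xb \<gamma> \<rho> \<mu>
               \<subseteq> (\<lambda>b. xb + (l * norm (\<mu> - \<mu>b)) *\<^sub>R b) ` cball 0 1 \<and>
             local_solutions f \<Phi> xb \<gamma> \<rho> \<mu> \<noteq> {} \<and>
             local_solutions f \<Phi> xb \<gamma> \<rho> \<mu> \<subseteq> interior (cball xb \<gamma>)"
proof -
  have normal: "\<mu>b \<in> normal_cone soc (\<Phi> xb)"
    using assms(3) by (simp add: kkt_solution_def)
  then have feas: "\<Phi> xb \<in> soc" by (simp add: normal_cone_def)
  obtain \<Phi>' where "(\<Phi> has_derivative \<Phi>') (at xb)"
    using assms(2) by (rule C2_around_imp_has_derivative)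
  then obtain r K where rK: "r > 0" "K \<ge> 0"
    "\<And>x. x \<in> ball xb r \<Longrightarrow> norm (\<Phi> x - \<Phi> xb) \<le> K * norm (x - xb)"
    using has_derivative_imp_calm by blast
  obtain U where U: "open U" "xb \<in> U" "continuous_on U f"
    using assms(1) by (rule C2_around_imp_continuous)
  obtain V where V: "open V" "xb \<in> V" "continuous_on V \<Phi>"
    using assms(2) by (rule C2_around_imp_continuous)
  have "open (U \<inter> V \<inter> ball xb r)" "xb \<in> U \<inter> V \<inter> ball xb r"
    using U V rK by auto
  then obtain e where e: "e > 0" "cball xb e \<subseteq> U \<inter> V \<inter> ball xb r"
    using open_contains_cball by blast
  \<comment> \<open>On this ball the growth condition, the calmness estimate and the continuity of
    both functions hold together.\<close>
  define \<gamma> where "\<gamma> = min \<gamma>b e"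
  have \<gamma>: "\<gamma> > 0" "\<gamma> \<le> \<gamma>b" "cball xb \<gamma> \<subseteq> U \<inter> V \<inter> ball xb r"
    using e assms(5) by (auto simp: \<gamma>_def)
  \<comment> \<open>Chosen so that \<open>lb * l\<close> exceeds
    \<open>2 * K + inverse \<rho>b\<close> by exactly \<open>lb\<close>; only the threshold
    \<open>\<rho>b\<close> enters, which makes the constant uniform in \<rho>.\<close>
  define l where "l = 1 + (2 * K + inverse \<rho>b) / lb"
  have l: "l \<ge> 1" "2 * K + inverse \<rho>b < lb * l"
    using rK(2) assms(4,6) by (auto simp: l_def field_simps)
  \<comment> \<open>The factor 2 gives \<open>l * \<epsilon> = \<gamma> / 2\<close>, strictly inside
    the ball.\<close>
  define \<epsilon> where "\<epsilon> = \<gamma> / (2 * l)"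
  have \<epsilon>: "\<epsilon> > 0" "l * \<epsilon> < \<gamma>"
    using \<gamma>(1) l(1) by (auto simp: \<epsilon>_def)
  have bound: "norm (x - xb) \<le> l * norm (\<mu> - \<mu>b)"
    if "\<rho> \<ge> \<rho>b" and x: "x \<in> local_solutions f \<Phi> xb \<gamma> \<rho> \<mu>" for x \<mu> \<rho>
  proof -
    have \<rho>: "\<rho> > 0" using that(1) assms(4) by simp
    have x\<gamma>: "x \<in> cball xb \<gamma>"
      and xmin: "aug_lagrangian f \<Phi> x \<mu> \<rho> \<le> aug_lagrangian f \<Phi> xb \<mu> \<rho>"
      using x \<gamma>(1) by (auto simp: local_solutions_def is_arg_min_linorder)
    define g where "g = \<Phi> x - closest_point soc (\<Phi> x + inverse \<rho> *\<^sub>R \<mu>)"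
    have "norm g \<le> 2 * norm (\<Phi> x - \<Phi> xb) + inverse \<rho> * norm (\<mu> - \<mu>b)"
      unfolding g_def by (rule supergradient_norm_le[where \<Phi> = \<Phi>, OF normal \<rho>])
    \<comment> \<open>Calmness at \<open>xb\<close> bounds the first term, and
      \<open>\<rho> \<ge> \<rho>b\<close> removes \<rho> from the second.\<close>
    also have "\<dots> \<le> 2 * (K * norm (x - xb)) + inverse \<rho>b * norm (\<mu> - \<mu>b)"
      using rK(3)[of x] x\<gamma> \<gamma>(3) that(1) assms(4)
      by (intro add_mono mult_left_mono mult_right_mono le_imp_inverse_le) auto
    finally have g: "norm g \<le> 2 * K * norm (x - xb) + inverse \<rho>b * norm (\<mu> - \<mu>b)" by simp
    have "x \<in> cball xb \<gamma>b" using x\<gamma> \<gamma>(2) by auto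
    then have "f xb + lb * (norm (x - xb))\<^sup>2 \<le> aug_lagrangian f \<Phi> x \<mu>b \<rho>"
      using assms(7) that(1) by blast
    \<comment> \<open>The supergradient is taken at \<mu> and tested at \<open>\<mu>b\<close>, which
      carries the growth at \<open>\<mu>b\<close> over to the function that \<open>x\<close>
      minimizes.\<close>
    also have "\<dots> \<le> aug_lagrangian f \<Phi> x \<mu> \<rho> + g \<bullet> (\<mu>b - \<mu>)"
      unfolding g_def by (rule aug_lagrangian_supergradient[OF \<rho>])
    \<comment> \<open>Minimality compares \<open>x\<close> with \<open>xb\<close>, whose value is at
      most \<open>f xb\<close> by feasibility.\<close>
    also have "\<dots> \<le> f xb + norm g * norm (\<mu> - \<mu>b)"
      using xmin aug_lagrangian_le_objective[where \<Phi> = \<Phi>, OF feas \<rho>, of f \<mu>]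
        norm_cauchy_schwarz[of g "\<mu>b - \<mu>"]
      by (simp add: norm_minus_commute)
    also have "\<dots> \<le> f xb + (2 * K * norm (x - xb) + inverse \<rho>b * norm (\<mu> - \<mu>b)) * norm (\<mu> - \<mu>b)"
      using g by (intro add_left_mono mult_right_mono) auto
    finally have growth: "lb * (norm (x - xb))\<^sup>2
        \<le> (2 * K * norm (x - xb) + inverse \<rho>b * norm (\<mu> - \<mu>b)) * norm (\<mu> - \<mu>b)"
      by (simp only: add_le_cancel_left)
    have "0 \<le> 2 * K" "0 \<le> inverse \<rho>b" using rK(2) assms(4) by simp_all
    from quadratic_growth_imp_linear_bound[OF growth norm_ge_zero norm_ge_zero this l]
    show ?thesis .
  qed
  have "local_solutions f \<Phi> xb \<gamma> \<rho> \<mu>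
          \<subseteq> (\<lambda>b. xb + (l * norm (\<mu> - \<mu>b)) *\<^sub>R b) ` cball 0 1 \<and>
        local_solutions f \<Phi> xb \<gamma> \<rho> \<mu> \<noteq> {} \<and>
        local_solutions f \<Phi> xb \<gamma> \<rho> \<mu> \<subseteq> interior (cball xb \<gamma>)"
    if \<mu>: "\<mu> \<in> cball \<mu>b \<epsilon>" and \<rho>: "\<rho> \<ge> \<rho>b" for \<mu> \<rho>
  proof (intro conjI subsetI)
    fix x assume "x \<in> local_solutions f \<Phi> xb \<gamma> \<rho> \<mu>"
    then have le: "norm (x - xb) \<le> l * norm (\<mu> - \<mu>b)" by (rule bound[OF \<rho>])
    show "x \<in> (\<lambda>b. xb + (l * norm (\<mu> - \<mu>b)) *\<^sub>R b) ` cball 0 1"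
    proof (rule image_eqI)
      \<comment> \<open>For \<open>\<mu> = \<mu>b\<close> the radius is 0 and \<open>le\<close>
        forces \<open>x = xb\<close>; the inverse of 0 is 0, so the witness is the zero
        vector.\<close>
      show "x = xb + (l * norm (\<mu> - \<mu>b)) *\<^sub>R ((x - xb) /\<^sub>R (l * norm (\<mu> - \<mu>b)))"
        using le l(1) by (cases "\<mu> = \<mu>b") (auto simp: field_simps)
      show "(x - xb) /\<^sub>R (l * norm (\<mu> - \<mu>b)) \<in> cball 0 1"
        using le l(1) by (cases "\<mu> = \<mu>b") (auto simp: divide_simps mult_ac)
    qed
    \<comment> \<open>With \<open>l * \<epsilon> < \<gamma>\<close> the linear bound puts
      \<open>x\<close> in the open ball, which is the interior of the closed one.\<close>
    have "l * norm (\<mu> - \<mu>b) \<le> l * \<epsilon>"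
      using \<mu> l(1) by (intro mult_left_mono) (auto simp: dist_norm norm_minus_commute)
    then show "x \<in> interior (cball xb \<gamma>)"
      using le \<epsilon>(2) by (simp add: dist_norm norm_minus_commute)
  next
    show "local_solutions f \<Phi> xb \<gamma> \<rho> \<mu> \<noteq> {}"
      using \<gamma> U(3) V(3) by (intro local_solutions_nonempty) (auto intro: continuous_on_subset)
  qed
  moreover have "l > 0" using l(1) by simp
  ultimately show ?thesis
    using \<gamma>(1,2) \<epsilon>(1) by (intro exI[of _ l] exI[of _ \<epsilon>] bexI[of _ \<gamma>] conjI ballI allI impI) auto
qed

end
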